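(* Let $R$ be a commutative semiring, $\varphi:R\to U$ a tangibly additive supervaluation, and $a=(a_1,\dots,a_n)\in R^n$. Then for every polynomial $f\in R[\lambda]=R[\lambda_1,\dots,\lambda_n]$ $$\varepsilon_{\varphi(a)}(\tilde\varphi(f))\ \models_{\mathrm{gs}}\ \varphi(\varepsilon_a(f)).$$
   Context: All semirings are commutative with $0$ and $1$. A semiring $M$ is bipotent if $a+b\in\{a,b\}$ for all $a,b\in M$; it is totally ordered by $a\le b\iff a+b=b$. A supertropical semiring is a semiring $U$ such that, with $e=e_U:=1+1$: (1) $1+1=1+1+1+1$; (2) $a+a=b+b$ implies $a+b=a+a$; (3) $a+a\ne b+b$ implies $a+b\in\{a,b\}$. Then $e$ is idempotent and $eU$ is a bipotent semiring with unit element $e$; its elements are called ghost. $\mathcal T(U):=U\setminus eU$ is the set of tangible elements. A supervaluation on $R$ is a map $\varphi:R\to U$ into a supertropical semiring with $\varphi(0)=0$, $\varphi(1)=1$, $\varphi(ab)=\varphi(a)\varphi(b)$ and $e\varphi(a+b)\le e\varphi(a)+e\varphi(b)$ for all $a,b\in R$. It is tangibly additive if for all $a,b\in R$ with $\varphi(a)+\varphi(b)\in\mathcal T(U)$ one has $\varphi(a)+\varphi(b)=\varphi(a+b)$. The ghost surpassing relation on $U$: $x\models_{\mathrm{gs}}y$ iff there is $z\in eU$ with $x=y+z$. For $f=\sum_i c_i\lambda^i\in R[\lambda]$ ($i\in\mathbb N_0^n$ multi-indices, $\lambda^i=\lambda_1^{i_1}\cdots\lambda_n^{i_n}$, finitely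 many $c_i\neq0$) put $\tilde\varphi(f)=\sum_i\varphi(c_i)\lambda^i\in U[\lambda]$. For $a\in R^n$, $\varepsilon_a:R[\lambda]\to R$ is evaluation $f\mapsto f(a)$; $\varphi(a)=(\varphi(a_1),\dots,\varphi(a_n))\in U^n$, and $\varepsilon_{\varphi(a)}:U[\lambda]\to U$ is evaluation at $\varphi(a)$. *)

theory Defs
  imports "HOL-Library.Poly_Mapping"
begin

(* A commutative semiring with 0 and 1 is a type of sort {comm_semiring_0, comm_monoid_mult}.
   The library class comm_semiring_1 would in addition exclude the trivial semiring (0 = 1). *)

class supertropical_semiring = comm_semiring_0 + comm_monoid_mult +
  assumes supertropical_1: "1 + 1 = 1 + 1 + 1 + 1"
    and supertropical_2: "a + a = b + b \<Longrightarrow> a + b = a + a"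
    and supertropical_3: "a + a \<noteq> b + b \<Longrightarrow> a + b \<in> {a, b}"

definition ghost_unit :: "'u::supertropical_semiring" where
  "ghost_unit = 1 + 1"

definition ghosts :: "'u::supertropical_semiring set" where
  "ghosts = range (\<lambda>x. ghost_unit * x)"

definition tangibles :: "'u::supertropical_semiring set" where
  "tangibles = - ghosts"

(* The total order of a bipotent semiring; below it is only applied to elements of the
   bipotent semiring eU of ghosts. *)
definition bipotent_le :: "'u::plus \<Rightarrow> 'u \<Rightarrow> bool" where
  "bipotent_le x y \<longleftrightarrow> x + y = y"

definition ghost_surpasses :: "'u::supertropical_semiring \<Rightarrow> 'u \<Rightarrow> bool" where
  "ghost_surpasses x y \<longleftrightarrow> (\<exists>z\<in>ghosts. x = y + z)"

definition supervaluation ::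
  "('r::{comm_semiring_0, comm_monoid_mult} \<Rightarrow> 'u::supertropical_semiring) \<Rightarrow> bool" where
  "supervaluation \<phi> \<longleftrightarrow>
     \<phi> 0 = 0 \<and> \<phi> 1 = 1 \<and>
     (\<forall>a b. \<phi> (a * b) = \<phi> a * \<phi> b) \<and>
     (\<forall>a b. bipotent_le (ghost_unit * \<phi> (a + b)) (ghost_unit * \<phi> a + ghost_unit * \<phi> b))"

definition tangibly_additive ::
  "('r::{comm_semiring_0, comm_monoid_mult} \<Rightarrow> 'u::supertropical_semiring) \<Rightarrow> bool" where
  "tangibly_additive \<phi> \<longleftrightarrow> (\<forall>a b. \<phi> a + \<phi> b \<in> tangibles \<longrightarrow> \<phi> a + \<phi> b = \<phi> (a + b))"

(* Polynomials in finitely many variables indexed by 'n, as finitely supported maps from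
   multi-indices (elements of 'n \<Rightarrow>\<^sub>0 nat) to coefficients. *)
type_synonym ('n, 'r) mpoly = "('n \<Rightarrow>\<^sub>0 nat) \<Rightarrow>\<^sub>0 'r"

definition eval_mpoly ::
  "('n::finite \<Rightarrow> 'r) \<Rightarrow> ('n, 'r::{comm_semiring_0, comm_monoid_mult}) mpoly \<Rightarrow> 'r" where
  "eval_mpoly a f =
     (\<Sum>i\<in>Poly_Mapping.keys f.
        Poly_Mapping.lookup f i * (\<Prod>k\<in>UNIV. a k ^ Poly_Mapping.lookup i k))"

(* Poly_Mapping.map sends coefficients equal to 0 to 0 irrespective of \<phi>; this is
   coefficientwise application of \<phi> because a supervaluation satisfies \<phi> 0 = 0. *)
definition map_coeffs ::
  "('r::{comm_semiring_0, comm_monoid_mult} \<Rightarrow> 'u::supertropical_semiring) \<Rightarrow>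
     ('n, 'r) mpoly \<Rightarrow> ('n, 'u) mpoly" where
  "map_coeffs \<phi> f = Poly_Mapping.map \<phi> f"

end

theory Submission
  imports Defs
begin

text \<open>
  Evaluating the image of \<open>f\<close> at \<open>\<phi>(a)\<close> gives, by multiplicativity of \<open>\<phi>\<close>, the sum of the values
  \<open>\<phi>(m)\<close> over the monomials \<open>m\<close> of \<open>f\<close> evaluated at \<open>a\<close>. The claim is thus that \<open>\<phi>\<close> of a finite
  sum is ghost surpassed by the sum of the values. Since ghost surpassing is transitive and
  compatible with addition, this reduces to two summands (\<open>ghost_surpasses_add\<close>).

  For two summands, tangible additivity gives equality when \<open>\<phi> x + \<phi> y\<close> is tangible. Otherwise
  \<open>g = \<phi> x + \<phi> y\<close> is a ghost, and the supervaluation inequality says that the ghost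
  \<open>e * \<phi> (x + y)\<close> lies below \<open>g\<close>. A ghost absorbs every element whose ghost value it dominates
  (\<open>ghost_absorbs\<close>), so \<open>g = \<phi> (x + y) + g\<close>, which exhibits the surpassing relation with \<open>g\<close>
  itself as the ghost summand.
\<close>

lemma add_self_eq_ghost_unit_mult: "x + x = ghost_unit * (x :: 'u::supertropical_semiring)"
  by (simp add: ghost_unit_def distrib_right)

lemma ghost_unit_idem:
  "ghost_unit * ghost_unit = (ghost_unit :: 'u::supertropical_semiring)"
  using supertropical_1 [where 'a = 'u]
  by (simp add: ghost_unit_def distrib_right distrib_left add.assoc)

lemma ghost_unit_mult_ghost:
  assumes "g \<in> ghosts"
  shows "ghost_unit * g = (g :: 'u::supertropical_semiring)"
  using assms by (auto simp: ghosts_def mult.assoc [symmetric] ghost_unit_idem)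

lemma zero_in_ghosts: "0 \<in> (ghosts :: 'u::supertropical_semiring set)"
  unfolding ghosts_def by (rule range_eqI [where x = 0]) simp

lemma add_in_ghosts:
  assumes "x \<in> ghosts" and "y \<in> ghosts"
  shows "x + y \<in> (ghosts :: 'u::supertropical_semiring set)"
  using assms by (auto simp: ghosts_def distrib_left [symmetric])

lemma ghost_surpasses_refl: "ghost_surpasses x x"
  unfolding ghost_surpasses_def using zero_in_ghosts by (metis add_0_right)

lemma ghost_surpasses_trans:
  assumes "ghost_surpasses x y" and "ghost_surpasses y z"
  shows "ghost_surpasses x z"
  using assms unfolding ghost_surpasses_def by (metis add.assoc add_in_ghosts)

lemma ghost_surpasses_add_left:
  assumes "ghost_surpasses x y"
  shows "ghost_surpasses (w + x) (w + y)"
  using assms unfolding ghost_surpasses_def by (metis add.assoc)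

text \<open>
  If \<open>y\<close> and \<open>g\<close> have the same ghost value, their sum is that ghost value, hence \<open>g\<close>. If the
  ghost values differ, \<open>y + g\<close> is one of the summands; it cannot be \<open>y\<close>, since applying \<open>e\<close> would
  give \<open>g \<le> e * y\<close>, and with the assumed \<open>e * y \<le> g\<close> the ghost values would agree.
\<close>

lemma ghost_absorbs:
  fixes y g :: "'u::supertropical_semiring"
  assumes g: "g \<in> ghosts" and le: "bipotent_le (ghost_unit * y) g"
  shows "y + g = g"
proof (cases "ghost_unit * y = g")
  case True
  then have "g + g = y + y"
    by (simp add: add_self_eq_ghost_unit_mult ghost_unit_mult_ghost [OF g])
  then have "g + y = g + g"
    by (rule supertropical_2)
  then show ?thesis
    by (simp add: add_self_eq_ghost_unit_mult ghost_unit_mult_ghost [OF g] add.commute)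
next
  case False
  then have "y + y \<noteq> g + g"
    by (simp add: add_self_eq_ghost_unit_mult ghost_unit_mult_ghost [OF g])
  then have "y + g \<in> {y, g}"
    by (rule supertropical_3)
  moreover have "y + g \<noteq> y"
  proof
    assume "y + g = y"
    then have "ghost_unit * y + g = ghost_unit * y"
      by (metis distrib_left ghost_unit_mult_ghost [OF g])
    with le False show False
      by (simp add: bipotent_le_def)
  qed
  ultimately show ?thesis by simp
qed

lemma ghost_surpasses_add:
  fixes \<phi> :: "'r::{comm_semiring_0, comm_monoid_mult} \<Rightarrow> 'u::supertropical_semiring"
  assumes sv: "supervaluation \<phi>" and ta: "tangibly_additive \<phi>"
  shows "ghost_surpasses (\<phi> x + \<phi> y) (\<phi> (x + y))"
proof (cases "\<phi> x + \<phi> y \<in> tangibles")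
  case True
  with ta have "\<phi> x + \<phi> y = \<phi> (x + y)"
    by (simp add: tangibly_additive_def)
  then show ?thesis by (simp add: ghost_surpasses_refl)
next
  case False
  then have g: "\<phi> x + \<phi> y \<in> ghosts"
    by (simp add: tangibles_def)
  have "bipotent_le (ghost_unit * \<phi> (x + y)) (ghost_unit * (\<phi> x + \<phi> y))"
    using sv by (simp add: supervaluation_def distrib_left)
  then have "\<phi> (x + y) + (\<phi> x + \<phi> y) = \<phi> x + \<phi> y"
    using g by (simp add: ghost_absorbs ghost_unit_mult_ghost)
  with g show ?thesis
    unfolding ghost_surpasses_def by metis
qed

lemma ghost_surpasses_sum:
  fixes \<phi> :: "'r::{comm_semiring_0, comm_monoid_mult} \<Rightarrow> 'u::supertropical_semiring"
  assumes sv: "supervaluation \<phi>" and ta: "tangibly_additive \<phi>" and "finite I"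
  shows "ghost_surpasses (\<Sum>i\<in>I. \<phi> (x i)) (\<phi> (\<Sum>i\<in>I. x i))"
  using \<open>finite I\<close>
proof (induction I rule: finite_induct)
  case empty
  from sv show ?case by (simp add: supervaluation_def ghost_surpasses_refl)
next
  case (insert i I)
  have "ghost_surpasses (\<phi> (x i) + (\<Sum>i\<in>I. \<phi> (x i))) (\<phi> (x i) + \<phi> (\<Sum>i\<in>I. x i))"
    using insert.IH by (rule ghost_surpasses_add_left)
  moreover have "ghost_surpasses (\<phi> (x i) + \<phi> (\<Sum>i\<in>I. x i)) (\<phi> (x i + (\<Sum>i\<in>I. x i)))"
    using sv ta by (rule ghost_surpasses_add)
  ultimately have "ghost_surpasses (\<phi> (x i) + (\<Sum>i\<in>I. \<phi> (x i))) (\<phi> (x i + (\<Sum>i\<in>I. x i)))"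
    by (rule ghost_surpasses_trans)
  with insert.hyps show ?case by simp
qed

lemma supervaluation_power:
  assumes "supervaluation \<phi>"
  shows "\<phi> (x ^ n) = \<phi> x ^ n"
  using assms by (induction n) (simp_all add: supervaluation_def)

lemma supervaluation_prod:
  assumes "supervaluation \<phi>"
  shows "\<phi> (\<Prod>k\<in>K. x k) = (\<Prod>k\<in>K. \<phi> (x k))"
  using assms by (induction K rule: infinite_finite_induct) (simp_all add: supervaluation_def)

lemma eval_mpoly_map_coeffs:
  fixes \<phi> :: "'r::{comm_semiring_0, comm_monoid_mult} \<Rightarrow> 'u::supertropical_semiring"
    and a :: "'n::finite \<Rightarrow> 'r"
    and f :: "('n, 'r) mpoly"
  assumes sv: "supervaluation \<phi>"
  shows "eval_mpoly (\<lambda>k. \<phi> (a k)) (map_coeffs \<phi> f) =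
    (\<Sum>i\<in>Poly_Mapping.keys f.
      \<phi> (Poly_Mapping.lookup f i * (\<Prod>k\<in>UNIV. a k ^ Poly_Mapping.lookup i k)))"
proof -
  have \<phi>0: "\<phi> 0 = 0" and mult: "\<And>x y. \<phi> (x * y) = \<phi> x * \<phi> y"
    using sv by (simp_all add: supervaluation_def)
  have lookup: "Poly_Mapping.lookup (map_coeffs \<phi> f) i = \<phi> (Poly_Mapping.lookup f i)" for i
    by (simp add: map_coeffs_def map.rep_eq when_def \<phi>0)
  \<comment> \<open>The inclusion may be strict: \<open>\<phi>\<close> can send nonzero coefficients to \<open>0\<close>.\<close>
  have "Poly_Mapping.keys (map_coeffs \<phi> f) \<subseteq> Poly_Mapping.keys f"
    using \<phi>0 by (auto simp: lookup in_keys_iff)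
  then have "eval_mpoly (\<lambda>k. \<phi> (a k)) (map_coeffs \<phi> f) =
    (\<Sum>i\<in>Poly_Mapping.keys f.
      \<phi> (Poly_Mapping.lookup f i) * (\<Prod>k\<in>UNIV. \<phi> (a k) ^ Poly_Mapping.lookup i k))"
    unfolding eval_mpoly_def
    by (intro sum.mono_neutral_cong_left) (auto simp: lookup in_keys_iff)
  also have "\<dots> = (\<Sum>i\<in>Poly_Mapping.keys f.
      \<phi> (Poly_Mapping.lookup f i * (\<Prod>k\<in>UNIV. a k ^ Poly_Mapping.lookup i k)))"
    by (simp add: mult supervaluation_prod [OF sv] supervaluation_power [OF sv])
  finally show ?thesis .
qed

theorem theorem9p11:
  fixes \<phi> :: "'r::{comm_semiring_0, comm_monoid_mult} \<Rightarrow> 'u::supertropical_semiring"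
    and a :: "'n::finite \<Rightarrow> 'r"
    and f :: "('n, 'r) mpoly"
  assumes "supervaluation \<phi>"
    and "tangibly_additive \<phi>"
  shows "ghost_surpasses (eval_mpoly (\<lambda>k. \<phi> (a k)) (map_coeffs \<phi> f)) (\<phi> (eval_mpoly a f))"
  unfolding eval_mpoly_map_coeffs [OF assms(1)]
  unfolding eval_mpoly_def
  using assms by (intro ghost_surpasses_sum) simp_all

end
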